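(* Let $K$ be a compact zerodimensional space supporting a strictly positive measure $\mu$ (i.e. $\mu(U)>0$ for every nonempty open $U\subseteq K$), and let $f\colon K\to 2^\omega$ be a finite-to-one continuous map (every fiber $f^{-1}[\{t\}]$ is finite). Then $K$ is separable.
   Context: A measure on a compact space means a Radon probability measure on its Borel sets. *)

theory Defs
  imports "HOL-Analysis.Analysis" "HOL-Probability.Probability_Measure"
begin

definition zerodimensional_space :: "'a topology \<Rightarrow> bool" where
  "zerodimensional_space X \<longleftrightarrow> neighbourhood_base_of (\<lambda>U. openin X U \<and> closedin X U) X"

lemma zerodimensional_space_iff_dim_le_0: "zerodimensional_space X \<longleftrightarrow> X dim_le 0"
  by (simp add: zerodimensional_space_def dimension_le_0_neighbourhood_base_of_clopen conj_commute)

definition borel_sigma_algebra_of :: "'a topology \<Rightarrow> 'a measure" where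
  "borel_sigma_algebra_of X = sigma (topspace X) {U. openin X U}"

text \<open>The condition \<open>C \<in> sets M\<close> is redundant when \<open>X\<close> is Hausdorff.\<close>

definition radon_probability_measure_on :: "'a topology \<Rightarrow> 'a measure \<Rightarrow> bool" where
  "radon_probability_measure_on X M \<longleftrightarrow>
     prob_space M \<and>
     sets M = sets (borel_sigma_algebra_of X) \<and>
     (\<forall>B\<in>sets M. emeasure M B = (SUP C\<in>{C. compactin X C \<and> C \<in> sets M \<and> C \<subseteq> B}. emeasure M C))"

definition strictly_positive_measure_on :: "'a topology \<Rightarrow> 'a measure \<Rightarrow> bool" where
  "strictly_positive_measure_on X M \<longleftrightarrow> (\<forall>U. openin X U \<and> U \<noteq> {} \<longrightarrow> 0 < emeasure M U)"

abbreviation cantor_space :: "(nat \<Rightarrow> bool) topology" where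
  "cantor_space \<equiv> product_topology (\<lambda>_. discrete_topology UNIV) UNIV"

end

theory Submission
  imports Defs
begin

text \<open>
  Among the closures of countable sets there is one, \<open>S\<close>, of maximal measure. If \<open>S \<noteq> K\<close>, then
  strict positivity and inner regularity give a compact \<open>C\<^sub>0\<close> of positive measure disjoint from
  \<open>S\<close>. Any compact \<open>C\<close> contains the closure \<open>E\<close> of a countable set with \<open>f[E] = f[C]\<close> (lift a
  countable dense subset of \<open>f[C]\<close>), and for \<open>C \<subseteq> C\<^sub>0\<close> maximality makes \<open>E\<close> null, so \<open>C - E\<close>
  contains a compact set of positive measure. Iterating yields decreasing compact sets \<open>C\<^sub>n\<close> and
  pairwise disjoint sets \<open>E\<^sub>n \<subseteq> C\<^sub>n\<close> with \<open>f[E\<^sub>n] = f[C\<^sub>n]\<close>; the fibre of \<open>f\<close> through a point of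
  \<open>\<Inter>n. C\<^sub>n\<close> meets every \<open>E\<^sub>n\<close> and is therefore infinite.
\<close>

lemma second_countable_euclidean:
  "second_countable (euclidean :: 'a::second_countable_topology topology)"
proof -
  obtain B :: "'a set set" where "countable B" "topological_basis B"
    using ex_countable_basis by blast
  then show ?thesis
    unfolding second_countable_def
    by (metis open_openin topological_basisE topological_basis_open)
qed

text \<open>The order topology on \<open>bool\<close> is generated by finitely many rays. With this
  instance, \<open>nat \<Rightarrow> bool\<close> becomes second countable as a countable
  product.\<close>

instance bool :: second_countable_topology
proof
  show "\<exists>B::bool set set. countable B \<and> open = generate_topology B"
    by (intro exI[of _ "range lessThan \<union> range greaterThan"]) (auto simp: open_bool_def)
qed

lemma second_countable_cantor_space: "second_countable cantor_space"
proof -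
  \<comment> \<open>This identifies \<open>cantor_space\<close> with the type-class topology on
    \<open>nat \<Rightarrow> bool\<close>.\<close>
  have "(euclidean :: bool topology) = discrete_topology UNIV"
    by (simp add: topology_eq open_discrete flip: open_openin)
  then show ?thesis
    using second_countable_euclidean[where 'a = "nat \<Rightarrow> bool"]
    by (simp flip: euclidean_product_topology)
qed

text \<open>Choose \<open>D\<close> in \<open>C\<close> mapping onto a countable dense subset of
  \<open>f\<close> C\<open>. Its closure stays in the closed set\<close>C\<open>, hence is compact;
  the image of that closure is then closed in\<close>Y\<open>and contains a dense subset of\<close>f
  \<open>C\<close>.\<close>

lemma compactin_image_eq_image_closure_countable:
  assumes K: "Hausdorff_space K" and Y: "Hausdorff_space Y" "second_countable Y"
    and f: "continuous_map K Y f" and C: "compactin K C"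
  obtains D where "countable D" "D \<subseteq> C" "K closure_of D \<subseteq> C" "f ` (K closure_of D) = f ` C"
proof -
  have fC: "f ` C \<subseteq> topspace Y"
    using f C by (meson compactin_subset_topspace image_compactin)
  have "separable_space (subtopology Y (f ` C))"
    by (simp add: Y second_countable_imp_separable_space second_countable_subtopology)
  then obtain T where T: "countable T" "T \<subseteq> f ` C" "f ` C \<subseteq> Y closure_of T"
    using fC unfolding separable_space_def
    by (metis closure_of_subtopology inf.absorb_iff2 inf.cobounded2 topspace_subtopology)
  obtain D where D: "countable D" "D \<subseteq> C" "T = f ` D"
    using T countable_subset_image by metis
  have clC: "K closure_of D \<subseteq> C"
    by (simp add: C D(2) K closure_of_minimal compactin_imp_closedin)
  have "compactin K (K closure_of D)"
    using C clC closed_compactin closedin_closure_of by blast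
  then have "closedin Y (f ` (K closure_of D))"
    using Y f compactin_imp_closedin image_compactin by blast
  moreover have "T \<subseteq> f ` (K closure_of D)"
    using D C closure_of_subset[of D K] compactin_subset_topspace by blast
  ultimately have "f ` C \<subseteq> f ` (K closure_of D)"
    using T(3) closure_of_minimal by blast
  with clC have "f ` (K closure_of D) = f ` C" by blast
  with D(1,2) clC show ?thesis by (rule that)
qed

lemma closedin_in_sets_borel_sigma_algebra_of:
  assumes "closedin X S"
  shows "S \<in> sets (borel_sigma_algebra_of X)"
proof -
  have "{U. openin X U} \<subseteq> Pow (topspace X)"
    by (auto dest: openin_subset)
  moreover have "S = topspace X - (topspace X - S)" "openin X (topspace X - S)"
    using assms closedin_subset by auto
  ultimately show ?thesis
    unfolding borel_sigma_algebra_of_def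
    by (metis mem_Collect_eq sets.compl_sets sets_measure_of sigma_sets.Basic space_measure_of)
qed

lemma radon_probability_measure_on_ex_compactin:
  assumes "radon_probability_measure_on X M" "B \<in> sets M" "0 < emeasure M B"
  obtains C where "compactin X C" "C \<in> sets M" "C \<subseteq> B" "0 < emeasure M C"
proof -
  have "0 < (SUP C\<in>{C. compactin X C \<and> C \<in> sets M \<and> C \<subseteq> B}. emeasure M C)"
    using assms by (simp add: radon_probability_measure_on_def)
  then show ?thesis
    using that by (auto simp: less_SUP_iff)
qed

text \<open>A supremum in \<open>ennreal\<close> is already reached along a sequence, and the union
  of the corresponding countable sets is countable and dominates them all.\<close>

lemma ex_countable_closure_of_maximal_measure:
  assumes "sets M = sets (borel_sigma_algebra_of X)"
  obtains D where "countable D" "D \<subseteq> topspace X"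
    "\<And>E. countable E \<Longrightarrow> E \<subseteq> topspace X \<Longrightarrow>
       emeasure M (X closure_of E) \<le> emeasure M (X closure_of D)"
proof -
  let ?A = "{D. countable D \<and> D \<subseteq> topspace X}"
  let ?m = "\<lambda>D. emeasure M (X closure_of D)"
  obtain m :: "nat \<Rightarrow> ennreal" where m: "range m \<subseteq> ?m ` ?A" "Sup (?m ` ?A) = (SUP n. m n)"
    using ennreal_Sup_countable_SUP[of "?m ` ?A"] by blast
  then have "\<forall>n. \<exists>D\<in>?A. m n = ?m D" by blast
  then obtain D where D: "\<And>n. D n \<in> ?A" "\<And>n. m n = ?m (D n)" by metis
  have le: "m n \<le> ?m (\<Union>n. D n)" for n
    unfolding D(2) using assms
    by (intro emeasure_mono closure_of_mono)
       (auto simp: closedin_in_sets_borel_sigma_algebra_of)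
  show ?thesis
  proof
    show "countable (\<Union>n. D n)" "(\<Union>n. D n) \<subseteq> topspace X"
      using D(1) by auto
    fix E assume "countable E" "E \<subseteq> topspace X"
    then have "?m E \<le> Sup (?m ` ?A)" by (intro SUP_upper) auto
    also have "\<dots> \<le> ?m (\<Union>n. D n)" unfolding m(2) by (intro SUP_least le)
    finally show "?m E \<le> ?m (\<Union>n. D n)" .
  qed
qed

text \<open>Cantor's intersection theorem in the compact space \<open>C 0\<close> gives a point
  \<open>x\<close> common to all \<open>C n\<close>; equality of the images puts a point of its
  fibre into each \<open>E n\<close>.\<close>

lemma infinite_fiber_of_nested_compact:
  assumes K: "Hausdorff_space K"
    and C: "\<And>n. compactin K (C n)" "\<And>n. C n \<noteq> {}"
    and E: "\<And>n. E n \<subseteq> C n" "\<And>n. f ` E n = f ` C n" "\<And>n. C (Suc n) \<subseteq> C n - E n"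
  shows "\<exists>t. infinite {x \<in> topspace K. f x = t}"
proof -
  have dec: "decseq C"
    using E(3) by (intro decseq_SucI) auto
  have "compact_space (subtopology K (C 0))"
    using C(1) compact_space_subtopology by blast
  moreover have "closedin (subtopology K (C 0)) (C n)" for n
    by (meson C(1) K closedin_subset_topspace compactin_imp_closedin dec decseqD le0)
  ultimately have "(\<Inter>n. C n) \<noteq> {}"
    using compact_space_imp_nest C(2) dec by metis
  then obtain x where x: "\<And>n. x \<in> C n" by auto
  then have "\<exists>y. y \<in> E n \<and> f y = f x" for n
    using E(2)[of n] by (metis image_iff imageI)
  then obtain y where y: "\<And>n. y n \<in> E n" "\<And>n. f (y n) = f x" by metis
  \<comment> \<open>\<open>E n\<close> lies in \<open>C n\<close>, hence in
    \<open>C (Suc m)\<close>, which avoids \<open>E m\<close>.\<close>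
  have "y m \<noteq> y n" if "m < n" for m n
    using y(1) E(1)[of n] E(3)[of m] decseqD[OF dec, of "Suc m" n] that
    by (metis Diff_iff Suc_leI subsetD)
  then have "inj y"
    by (metis injI linorder_neqE_nat)
  then have "infinite (range y)"
    by (simp add: finite_image_iff)
  moreover have "range y \<subseteq> {z \<in> topspace K. f z = f x}"
    using y E(1) C(1) compactin_subset_topspace by blast
  ultimately show ?thesis
    using finite_subset by blast
qed

theorem separable_space_if_finite_to_one_strictly_positive_measure:
  assumes K: "Hausdorff_space K" and Y: "Hausdorff_space Y" "second_countable Y"
    and \<mu>: "radon_probability_measure_on K \<mu>" "strictly_positive_measure_on K \<mu>"
    and f: "continuous_map K Y f"
    and fin: "\<And>t. t \<in> topspace Y \<Longrightarrow> finite {x \<in> topspace K. f x = t}"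
  shows "separable_space K"
proof -
  interpret prob_space \<mu>
    using \<mu>(1) by (simp add: radon_probability_measure_on_def)
  have sets: "sets \<mu> = sets (borel_sigma_algebra_of K)"
    using \<mu>(1) by (simp add: radon_probability_measure_on_def)
  have [measurable]: "K closure_of D \<in> sets \<mu>" for D
    by (simp add: sets closedin_in_sets_borel_sigma_algebra_of)
  obtain D where D: "countable D" "D \<subseteq> topspace K"
    and max: "\<And>E. countable E \<Longrightarrow> E \<subseteq> topspace K \<Longrightarrow>
       emeasure \<mu> (K closure_of E) \<le> emeasure \<mu> (K closure_of D)"
    using ex_countable_closure_of_maximal_measure[OF sets] by blast
  show ?thesis
  proof (rule ccontr)
    assume "\<not> separable_space K"
    then have "topspace K - K closure_of D \<noteq> {}"
      using D closure_of_subset_topspace[of K D] unfolding separable_space_def by blast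
    then have "0 < emeasure \<mu> (topspace K - K closure_of D)"
      using \<mu>(2) unfolding strictly_positive_measure_on_def
      by (simp add: openin_diff)
    moreover have "topspace K - K closure_of D \<in> sets \<mu>"
      unfolding sets using closedin_in_sets_borel_sigma_algebra_of[OF closedin_topspace]
      by (metis closedin_closure_of closedin_in_sets_borel_sigma_algebra_of sets.Diff)
    ultimately obtain C\<^sub>0 where C\<^sub>0: "compactin K C\<^sub>0" "C\<^sub>0 \<in> sets \<mu>" "0 < emeasure \<mu> C\<^sub>0"
      "C\<^sub>0 \<subseteq> topspace K - K closure_of D"
      using radon_probability_measure_on_ex_compactin[OF \<mu>(1)] by metis
    \<comment> \<open>Staying inside \<open>C\<^sub>0\<close> keeps every later closure disjoint
      from that of \<open>D\<close>; positive measure keeps the sets nonempty and lets the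
      construction continue.\<close>
    define P where "P C \<longleftrightarrow> compactin K C \<and> C \<in> sets \<mu> \<and> 0 < emeasure \<mu> C \<and> C \<subseteq> C\<^sub>0" for C
    have step: "\<exists>C'. P C' \<and> (\<exists>E\<subseteq>C. f ` E = f ` C \<and> C' \<subseteq> C - E)" if "P C" for C
    proof -
      have C: "compactin K C" "C \<in> sets \<mu>" "0 < emeasure \<mu> C" "C \<subseteq> C\<^sub>0"
        using that by (auto simp: P_def)
      obtain B where B: "countable B" "B \<subseteq> C" "K closure_of B \<subseteq> C"
        "f ` (K closure_of B) = f ` C"
        using compactin_image_eq_image_closure_countable[OF K Y f C(1)] .
      have "emeasure \<mu> (K closure_of B) + emeasure \<mu> (K closure_of D)
          = emeasure \<mu> (K closure_of (B \<union> D))"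
        using B(3) C(4) C\<^sub>0(4) by (subst plus_emeasure) auto
      also have "\<dots> \<le> emeasure \<mu> (K closure_of D)"
        using B D compactin_subset_topspace[OF C(1)] by (intro max) auto
      \<comment> \<open>The measure of the closure of \<open>D\<close> can be cancelled because it
        is finite.\<close>
      finally have "emeasure \<mu> (K closure_of B) = 0"
        by (simp add: emeasure_eq_measure order_antisym flip: ennreal_plus)
      then have "emeasure \<mu> (C - K closure_of B) = emeasure \<mu> C"
        using C(2) by (intro emeasure_Diff_null_set) auto
      then obtain C' where "compactin K C'" "C' \<in> sets \<mu>" "C' \<subseteq> C - K closure_of B"
        "0 < emeasure \<mu> C'"
        using radon_probability_measure_on_ex_compactin[OF \<mu>(1), of "C - K closure_of B"] C
        by auto
      then show ?thesis
        using B(3,4) C(4) unfolding P_def by blast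
    qed
    \<comment> \<open>Dependent choice runs on the sets \<open>C n\<close> alone; each
      \<open>E n\<close> is extracted afterwards from the relation between neighbours.\<close>
    have "\<exists>C. \<forall>n. P (C n) \<and> (\<exists>E\<subseteq>C n. f ` E = f ` C n \<and> C (Suc n) \<subseteq> C n - E)"
    proof (rule dependent_nat_choice)
      show "\<exists>C. P C"
        using C\<^sub>0 P_def by blast
    qed (rule step)
    then obtain C E where C: "\<And>n. P (C n)" and E: "\<And>n. E n \<subseteq> C n" "\<And>n. f ` E n = f ` C n"
      "\<And>n. C (Suc n) \<subseteq> C n - E n"
      by metis
    have "compactin K (C n)" "C n \<noteq> {}" for n
      using C[of n] by (auto simp: P_def)
    then obtain t where t: "infinite {x \<in> topspace K. f x = t}"
      using infinite_fiber_of_nested_compact[where C = C and E = E, OF K _ _ E] by blast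
    \<comment> \<open>An infinite fibre is nonempty, so \<open>t\<close> is a value of
      \<open>f\<close> and \<open>fin\<close> applies to it.\<close>
    then obtain x where "x \<in> topspace K" "f x = t"
      using not_finite_existsD by blast
    then have "t \<in> topspace Y"
      using f continuous_map_image_subset_topspace by blast
    with fin t show False by blast
  qed
qed

theorem theorem3p4:
  fixes K :: "'a topology" and \<mu> :: "'a measure" and f :: "'a \<Rightarrow> (nat \<Rightarrow> bool)"
  assumes "compact_space K" and "Hausdorff_space K" and "zerodimensional_space K"
    and "radon_probability_measure_on K \<mu>"
    and "strictly_positive_measure_on K \<mu>"
    and "continuous_map K cantor_space f"
    and "\<And>t. t \<in> topspace cantor_space \<Longrightarrow> finite {x \<in> topspace K. f x = t}"
  shows "separable_space K"
proof -
  have "Hausdorff_space cantor_space"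
    by (simp add: Hausdorff_space_product_topology)
  then show ?thesis
    by (rule separable_space_if_finite_to_one_strictly_positive_measure
        [OF assms(2) _ second_countable_cantor_space assms(4-7)])
qed

end
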